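(* Let $n,k\in\mathbb N$ and let $T=(T_1,\ldots,T_k)$ be a $k$-tuple of $n\times n$ matrices in Jordan form over $\mathbb R$, where each $T_\nu$ consists of $p$ Jordan blocks of dimensions $n_1,\ldots,n_p$ (with $n_1+\cdots+n_p=n$, and $p,n_1,\ldots,n_p$ not depending on $\nu$), that is, $$T_\nu=\mathrm{Jrd}_{n_1,\gamma_\nu^{(1)}}\oplus\cdots\oplus\mathrm{Jrd}_{n_p,\gamma_\nu^{(p)}},\qquad 1\leq\nu\leq k,$$ with $\gamma_\nu^{(b)}\in\mathbb R$ for all $1\le \nu\le k$, $1\le b\le p$. Assume that $n_b>1$ for at least one $b\in\{1,\ldots,p\}$. (i) Suppose that $n_b\geq 3$ for at least one $b\in\{1,2,\ldots,p\}$. Then $T$ is not hypercyclic. (ii) If $k=n$ then $T$ is not hypercyclic.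
   Context: $\mathbb N$ denotes the positive integers and $\mathbb N_0=\mathbb N\cup\{0\}$. For $l\in\mathbb N$ and $\gamma\in\mathbb R$, $\mathrm{Jrd}_{l,\gamma}$ denotes the $l\times l$ Jordan block with eigenvalue $\gamma$: the diagonal entries equal $\gamma$, the entries on the first superdiagonal equal $1$, and all other entries are $0$. The symbol $\oplus$ denotes the block-diagonal direct sum of matrices. A $k$-tuple $T=(T_1,\ldots,T_k)$ of commuting $n\times n$ real matrices is called hypercyclic if there exists a vector $x\in\mathbb R^n$ such that the set $\{T_1^{m_1}T_2^{m_2}\cdots T_k^{m_k}x : m_1,\ldots,m_k\in\mathbb N_0\}$ is dense in $\mathbb R^n$. *)

theory Defs
  imports
    "HOL-Analysis.Abstract_Euclidean_Space"
    "Jordan_Normal_Form.Jordan_Normal_Form"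
begin

text \<open>
  The library topologises \<open>\<real>\<^sup>n\<close> for a numeric dimension \<open>n\<close> as \<^const>\<open>Euclidean_space\<close>, whose points
  are the functions \<open>nat \<Rightarrow> real\<close> vanishing from \<open>n\<close> on. \<open>vec_point\<close> identifies a vector of dimension
  \<open>n\<close> with such a point.
\<close>

definition vec_point :: "real vec \<Rightarrow> nat \<Rightarrow> real" where
  "vec_point v = (\<lambda>i. if i < dim_vec v then vec_index v i else 0)"

definition dense_vecs :: "nat \<Rightarrow> real vec set \<Rightarrow> bool" where
  "dense_vecs n S \<longleftrightarrow> Euclidean_space n closure_of (vec_point ` S) = topspace (Euclidean_space n)"

text \<open>A tuple of length \<open>k\<close> is a function of which only the values at \<open>1, \<dots>, k\<close> matter.\<close>

definition tuple_power :: "nat \<Rightarrow> nat \<Rightarrow> (nat \<Rightarrow> real mat) \<Rightarrow> (nat \<Rightarrow> nat) \<Rightarrow> real mat" where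
  "tuple_power n k T m = foldr (\<lambda>\<nu> A. T \<nu> ^\<^sub>m m \<nu> * A) [1..<Suc k] (1\<^sub>m n)"

text \<open>
  The notion is meant for tuples of pairwise commuting \<open>n \<times> n\<close> matrices; commutativity is not a
  conjunct here, so that the negation of \<open>hypercyclic\<close> cannot hold merely for lack of it.
  The tuples of equally partitioned Jordan matrices do commute, by \<open>jordan_matrix_commute\<close> below.
\<close>

definition hypercyclic :: "nat \<Rightarrow> nat \<Rightarrow> (nat \<Rightarrow> real mat) \<Rightarrow> bool" where
  "hypercyclic n k T \<longleftrightarrow>
     (\<exists>x \<in> carrier_vec n. dense_vecs n {tuple_power n k T m *\<^sub>v x | m. True})"

lemma bij_betw_vec_point: "bij_betw vec_point (carrier_vec n) (topspace (Euclidean_space n))"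
proof (rule bij_betwI[where g = "vec n"])
  show "vec_point \<in> carrier_vec n \<rightarrow> topspace (Euclidean_space n)"
    by (auto simp: vec_point_def topspace_Euclidean_space)
  show "vec n \<in> topspace (Euclidean_space n) \<rightarrow> carrier_vec n"
    by auto
  show "vec n (vec_point v) = v" if "v \<in> carrier_vec n" for v
    using that by (intro eq_vecI) (auto simp: vec_point_def)
  show "vec_point (vec n f) = f" if "f \<in> topspace (Euclidean_space n)" for f
    using that by (auto simp: vec_point_def topspace_Euclidean_space)
qed

lemma jordan_block_commute:
  fixes a b :: real
  shows "jordan_block l a * jordan_block l b = jordan_block l b * jordan_block l a"
proof -
  define N where "N = jordan_block l (0::real)"
  have N: "N \<in> carrier_mat l l" by (simp add: N_def)
  have J: "jordan_block l c = N + c \<cdot>\<^sub>m 1\<^sub>m l" for c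
    by (rule eq_matI) (auto simp: N_def)
  have P: "jordan_block l c * jordan_block l d = N * N + (c + d) \<cdot>\<^sub>m N + (c * d) \<cdot>\<^sub>m 1\<^sub>m l" for c d
  proof -
    have "N * (d \<cdot>\<^sub>m 1\<^sub>m l) = d \<cdot>\<^sub>m N" and "c \<cdot>\<^sub>m 1\<^sub>m l * N = c \<cdot>\<^sub>m N"
      and "c \<cdot>\<^sub>m 1\<^sub>m l * (d \<cdot>\<^sub>m 1\<^sub>m l) = (c * d) \<cdot>\<^sub>m (1\<^sub>m l :: real mat)"
      using N by (auto simp: mult_smult_distrib[of _ l l _ l] mult_smult_assoc_mat[of _ l l _ l])
    then have "jordan_block l c * jordan_block l d
        = (N * N + c \<cdot>\<^sub>m N) + (d \<cdot>\<^sub>m N + (c * d) \<cdot>\<^sub>m 1\<^sub>m l)"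
      unfolding J using N
      by (simp add: add_mult_distrib_mat[of _ l l _ _ l] mult_add_distrib_mat[of _ l l _ l])
    also have "\<dots> = N * N + (c + d) \<cdot>\<^sub>m N + (c * d) \<cdot>\<^sub>m 1\<^sub>m l"
      using N by (intro eq_matI) (auto simp: algebra_simps)
    finally show ?thesis .
  qed
  show ?thesis unfolding P by (simp only: add.commute[of a b] mult.commute[of a b])
qed

lemma jordan_matrix_commute:
  fixes \<gamma> \<delta> :: "'b \<Rightarrow> real"
  shows "jordan_matrix (map (\<lambda>b. (ns b, \<gamma> b)) bs) * jordan_matrix (map (\<lambda>b. (ns b, \<delta> b)) bs)
       = jordan_matrix (map (\<lambda>b. (ns b, \<delta> b)) bs) * jordan_matrix (map (\<lambda>b. (ns b, \<gamma> b)) bs)"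
proof (induction bs)
  case Nil
  then show ?case by simp
next
  case (Cons b bs)
  let ?J = "\<lambda>c. jordan_matrix (map (\<lambda>b. (ns b, c b)) bs)"
  let ?s = "sum_list (map ns bs)"
  have C: "?J c \<in> carrier_mat ?s ?s" for c :: "'b \<Rightarrow> real"
    by (rule carrier_matI) (simp_all only: jordan_matrix_dim map_map o_def fst_conv)
  have E: "jordan_matrix (map (\<lambda>b. (ns b, c b)) (b # bs))
      = four_block_mat (jordan_block (ns b) (c b)) (0\<^sub>m (ns b) ?s) (0\<^sub>m ?s (ns b)) (?J c)"
    for c :: "'b \<Rightarrow> real"
    using carrier_matD[OF C[of c]]
    by (simp only: jordan_matrix_def list.map prod.case diag_block_mat.simps Let_def jordan_block_index)
  have M: "jordan_matrix (map (\<lambda>b. (ns b, c b)) (b # bs)) * jordan_matrix (map (\<lambda>b. (ns b, d b)) (b # bs))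
      = four_block_mat (jordan_block (ns b) (c b) * jordan_block (ns b) (d b))
          (0\<^sub>m (ns b) ?s) (0\<^sub>m ?s (ns b)) (?J c * ?J d)"
    for c d :: "'b \<Rightarrow> real"
  proof -
    note B = jordan_block_carrier[of "ns b"]
    have Z: "0\<^sub>m (ns b) ?s \<in> carrier_mat (ns b) ?s" "0\<^sub>m ?s (ns b) \<in> carrier_mat ?s (ns b)"
      by (rule zero_carrier_mat)+
    have BB: "jordan_block (ns b) (c b) * jordan_block (ns b) (d b) \<in> carrier_mat (ns b) (ns b)"
      by (rule mult_carrier_mat[OF B B])
    have CC: "?J c * ?J d \<in> carrier_mat ?s ?s"
      by (rule mult_carrier_mat[OF C C])
    show ?thesis
      unfolding E
      unfolding mult_four_block_mat[OF B Z C B Z C]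
        left_mult_zero_mat[OF B] right_mult_zero_mat[OF B]
        left_mult_zero_mat[OF C] right_mult_zero_mat[OF C]
        left_mult_zero_mat[OF zero_carrier_mat]
        right_add_zero_mat[OF BB] left_add_zero_mat[OF CC]
        left_add_zero_mat[OF zero_carrier_mat] ..
  qed
  show ?case unfolding M Cons.IH jordan_block_commute[of "ns b" "\<gamma> b"] ..
qed

end

theory Submission
  imports Defs
begin

text \<open>
  If \<open>x\<close> is a hypercyclic vector, then every set that contains \<open>x\<close> and is mapped into itself by
  all \<open>T \<nu>\<close> meets every nonempty open set.

  When three consecutive coordinates \<open>a, b, c\<close> end a block, \<open>b\<^sup>2 - 2 * a * c\<close> turns
  into \<open>\<gamma>\<^sup>2 * (b\<^sup>2 - 2 * a * c) + c\<^sup>2\<close> under a Jordan block with eigenvalue \<open>\<gamma>\<close>, while \<open>c\<close> turns into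
  \<open>\<gamma> * c\<close>. Hence a lower bound of \<open>b\<^sup>2 - 2 * a * c\<close> by a multiple of \<open>c\<^sup>2\<close> is invariant.

  When all blocks have size at most 2, the coordinates \<open>ln \<bar>c\<bar>\<close>, where \<open>c\<close> ends a
  block, and \<open>b / c\<close>, where \<open>b, c\<close> form a block, turn each \<open>T \<nu>\<close> with nonzero eigenvalues into a
  translation of \<open>\<real>\<^sup>n\<close>; the other \<open>T \<nu>\<close> map everything to points with some \<open>c = 0\<close>, and the orbit
  never leaves these again. As \<open>n\<close> vectors of \<open>\<real>\<^sup>n\<close> always lie in a closed half-space, a
  half-space is invariant under \<open>n\<close> such translations.
\<close>

unbundle no vec_syntax

section \<open>Dense orbits and invariant sets\<close>

lemma mult_mat_vec_index:
  assumes "A \<in> carrier_mat n n" "y \<in> carrier_vec n" "i < n"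
  shows "(A *\<^sub>v y) $ i = (\<Sum>j<n. A $$ (i, j) * y $ j)"
  using assms by (simp add: mult_mat_vec_def scalar_prod_def lessThan_atLeast0)

lemma vec_point_index: "i < dim_vec v \<Longrightarrow> vec_point v i = v $ i"
  by (simp add: vec_point_def)

lemma continuous_on_coordinate [continuous_intros]:
  "continuous_on S (\<lambda>f :: nat \<Rightarrow> real. f i)"
  by (rule continuous_on_subset[OF continuous_on_product_coordinates]) simp

text \<open>\<open>Euclidean_space n\<close> carries the subspace topology of the product topology
  on \<open>nat \<Rightarrow> real\<close>, so its open sets are traces of sets that are
  \<open>open\<close> in the function type, and only \<open>open\<close> and
  \<open>continuous_on\<close> are needed below.\<close>

lemma dense_vecs_meets_open:
  assumes "dense_vecs n S" "open V" "v \<in> carrier_vec n" "vec_point v \<in> V"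
  shows "\<exists>w\<in>S. vec_point w \<in> V"
proof -
  have v: "vec_point v \<in> topspace (Euclidean_space n)"
    using assms(3) bij_betw_vec_point bij_betwE by blast
  then have "vec_point v \<in> Euclidean_space n closure_of (vec_point ` S)"
    using assms(1) by (simp add: dense_vecs_def)
  moreover have "openin (Euclidean_space n) (topspace (Euclidean_space n) \<inter> V)"
    using assms(2) unfolding Euclidean_space_def
    by (auto simp: openin_subtopology euclidean_product_topology)
  ultimately show ?thesis
    using v assms(4) unfolding in_closure_of by blast
qed

lemma tuple_power_mult_vec_closed:
  assumes "\<And>\<nu>. \<nu> \<in> {1..k} \<Longrightarrow> T \<nu> \<in> carrier_mat n n"
    and "\<And>\<nu> y. \<nu> \<in> {1..k} \<Longrightarrow> y \<in> S \<Longrightarrow> T \<nu> *\<^sub>v y \<in> S"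
    and "S \<subseteq> carrier_vec n" "x \<in> S"
  shows "tuple_power n k T m *\<^sub>v x \<in> S"
proof -
  have x: "x \<in> carrier_vec n" using assms by auto
  have power: "T \<nu> ^\<^sub>m j *\<^sub>v y \<in> S" if \<nu>: "\<nu> \<in> {1..k}" and "y \<in> S" for \<nu> j y
    using \<open>y \<in> S\<close>
  proof (induction j arbitrary: y)
    case 0
    then show ?case using assms(1)[OF \<nu>] assms(3) by auto
  next
    case (Suc j)
    have "T \<nu> ^\<^sub>m Suc j *\<^sub>v y = T \<nu> ^\<^sub>m j *\<^sub>v (T \<nu> *\<^sub>v y)"
      using assms(1)[OF \<nu>] assms(3) Suc.prems
      by (auto intro!: assoc_mult_mat_vec[of _ n n _ n] pow_carrier_mat)
    then show ?case using Suc.IH assms(2)[OF \<nu> Suc.prems] by simp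
  qed
  let ?P = "\<lambda>\<nu>s. foldr (\<lambda>\<nu> A. T \<nu> ^\<^sub>m m \<nu> * A) \<nu>s (1\<^sub>m n)"
  \<comment> \<open>Generalised to any list of indices; the dimension is carried along because
    associativity requires it.\<close>
  have "?P \<nu>s \<in> carrier_mat n n \<and> ?P \<nu>s *\<^sub>v x \<in> S" if "set \<nu>s \<subseteq> {1..k}" for \<nu>s
    using that
  proof (induction \<nu>s)
    case Nil
    then show ?case using x assms(4) by simp
  next
    case (Cons \<nu> \<nu>s)
    then have P: "?P \<nu>s \<in> carrier_mat n n" "?P \<nu>s *\<^sub>v x \<in> S" and \<nu>: "\<nu> \<in> {1..k}"
      by auto
    have pow: "T \<nu> ^\<^sub>m m \<nu> \<in> carrier_mat n n"
      using assms(1)[OF \<nu>] by (rule pow_carrier_mat)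
    have "?P (\<nu> # \<nu>s) *\<^sub>v x = T \<nu> ^\<^sub>m m \<nu> *\<^sub>v (?P \<nu>s *\<^sub>v x)"
      using assoc_mult_mat_vec[OF pow P(1) x] by simp
    moreover have "?P (\<nu> # \<nu>s) \<in> carrier_mat n n"
      using pow P(1) by simp
    ultimately show ?case using power[OF \<nu> P(2)] by simp
  qed
  from this[of "[1..<Suc k]"] show ?thesis
    unfolding tuple_power_def by (simp add: atLeastLessThanSuc_atLeastAtMost del: upt_Suc)
qed

text \<open>Each use ends in a contradiction: the invariant \<open>P\<close> fails throughout the
  open set \<open>V\<close>, and \<open>v\<close> shows that \<open>V\<close> meets the
  n-dimensional space.\<close>

lemma dense_orbit_meets_open:
  assumes dense: "dense_vecs n {tuple_power n k T m *\<^sub>v x | m. True}" and x: "x \<in> carrier_vec n"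
    and carrier: "\<And>\<nu>. \<nu> \<in> {1..k} \<Longrightarrow> T \<nu> \<in> carrier_mat n n"
    and "P x" and inv: "\<And>\<nu> y. \<lbrakk>\<nu> \<in> {1..k}; y \<in> carrier_vec n; P y\<rbrakk> \<Longrightarrow> P (T \<nu> *\<^sub>v y)"
    and V: "open V" "v \<in> carrier_vec n" "vec_point v \<in> V"
  shows "\<exists>y\<in>carrier_vec n. P y \<and> vec_point y \<in> V"
proof -
  obtain m where "vec_point (tuple_power n k T m *\<^sub>v x) \<in> V"
    using dense_vecs_meets_open[OF dense V] by blast
  moreover have "tuple_power n k T m *\<^sub>v x \<in> {y \<in> carrier_vec n. P y}"
  proof (rule tuple_power_mult_vec_closed[OF carrier])
    show "T \<nu> *\<^sub>v y \<in> {y \<in> carrier_vec n. P y}"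
      if "\<nu> \<in> {1..k}" "y \<in> {y \<in> carrier_vec n. P y}" for \<nu> y
      using that inv[OF that(1)] carrier[OF that(1)] by auto
  qed (use x \<open>P x\<close> in auto)
  ultimately show ?thesis by blast
qed

section \<open>Half-spaces containing n vectors\<close>

text \<open>Some nonzero vector is orthogonal to the last n - 1 vectors, and its sign can be chosen
  to suit the first.\<close>

lemma half_space_of_n_vectors:
  fixes v :: "nat \<Rightarrow> nat \<Rightarrow> real"
  assumes "n \<ge> 1"
  obtains \<phi> i where "i < n" "\<phi> i \<noteq> 0" "\<And>\<nu>. \<nu> \<in> {1..n} \<Longrightarrow> (\<Sum>i<n. \<phi> i * v \<nu> i) \<ge> 0"
proof -
  \<comment> \<open>A zero row replaces \<open>v 1\<close> and makes the matrix singular; row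
    \<open>r > 0\<close> is \<open>v (Suc r)\<close>, since the vectors are numbered from 1.\<close>
  define A where "A = mat n n (\<lambda>(r, i). if r = 0 then 0 else v (Suc r) i)"
  have A: "A \<in> carrier_mat n n" by (simp add: A_def)
  have "A = mat\<^sub>r n n (\<lambda>i. if i = 0 then 0\<^sub>v n else row A i)"
    by (rule eq_matI) (auto simp: A_def)
  then have "det A = 0" using det_row_0[of 0 n "row A"] A assms by fastforce
  then obtain w where w: "w \<in> carrier_vec n" "w \<noteq> 0\<^sub>v n" "A *\<^sub>v w = 0\<^sub>v n"
    using det_0_iff_vec_prod_zero_field[OF A] by blast
  obtain i where i: "i < n" "w $ i \<noteq> 0"
    using w(1,2) by (metis carrier_vecD eq_vecI index_zero_vec)
  have zero: "(\<Sum>i<n. w $ i * v \<nu> i) = 0" if "\<nu> \<in> {2..n}" for \<nu>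
  proof -
    have "\<nu> - 1 < n" using that by auto
    then have "(A *\<^sub>v w) $ (\<nu> - 1) = 0" using w(3) by simp
    then show ?thesis
      using mult_mat_vec_index[OF A w(1) \<open>\<nu> - 1 < n\<close>] that \<open>\<nu> - 1 < n\<close>
      by (simp add: A_def mult.commute del: index_mult_mat_vec)
  qed
  define s where "s = (if (\<Sum>i<n. w $ i * v 1 i) \<ge> 0 then 1 else - 1 :: real)"
  have "(\<Sum>i<n. s * w $ i * v \<nu> i) \<ge> 0" if "\<nu> \<in> {1..n}" for \<nu>
  proof -
    have "(\<Sum>i<n. s * w $ i * v \<nu> i) = s * (\<Sum>i<n. w $ i * v \<nu> i)"
      by (simp add: sum_distrib_left mult.assoc)
    moreover have "\<nu> = 1 \<or> \<nu> \<in> {2..n}" using that by auto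
    ultimately show ?thesis using zero[of \<nu>] by (auto simp: s_def)
  qed
  then show ?thesis using that[of i "\<lambda>i. s * w $ i"] i by (auto simp: s_def)
qed

section \<open>Entries of Jordan matrices\<close>

fun chained :: "nat list \<Rightarrow> nat \<Rightarrow> bool" where
  "chained [] i = False"
| "chained (l # ls) i = (if i < l then Suc i < l else chained ls (i - l))"

fun diag_entry :: "(nat \<times> 'a::zero) list \<Rightarrow> nat \<Rightarrow> 'a" where
  "diag_entry [] i = 0"
| "diag_entry ((l, a) # xs) i = (if i < l then a else diag_entry xs (i - l))"

lemma chained_less: "chained ls i \<Longrightarrow> Suc i < sum_list ls"
  by (induction ls arbitrary: i) (fastforce split: if_splits)+

lemma diag_entry_chained:
  "chained (map fst xs) i \<Longrightarrow> diag_entry xs (Suc i) = diag_entry xs i"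
proof (induction xs arbitrary: i)
  case (Cons x xs)
  show ?case
  proof (cases "i < fst x")
    case True
    then show ?thesis using Cons.prems by (cases x) simp
  next
    case False
    then show ?thesis using Cons by (cases x) (simp add: Suc_diff_le)
  qed
qed simp

lemma chained_twice:
  assumes "l \<in> set ls" "l \<ge> 3"
  shows "\<exists>i. chained ls i \<and> chained ls (Suc i)"
  using assms
proof (induction ls)
  case (Cons a ls)
  show ?case
  proof (cases "l = a")
    case True
    then show ?thesis using Cons.prems by (intro exI[of _ 0]) simp
  next
    case False
    then obtain i where "chained ls i" "chained ls (Suc i)" using Cons by auto
    then show ?thesis by (intro exI[of _ "a + i"]) (simp add: Suc_diff_le)
  qed
qed simp

lemma jordan_matrix_index:
  fixes xs :: "(nat \<times> 'a::{zero,one}) list"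
  assumes "i < sum_list (map fst xs)" "j < sum_list (map fst xs)"
  shows "jordan_matrix xs $$ (i, j) = (if i = j then diag_entry xs i
    else if j = Suc i \<and> chained (map fst xs) i then 1 else 0)"
  using assms
proof (induction xs arbitrary: i j)
  case (Cons x xs)
  obtain l a where x: "x = (l, a)" by fastforce
  let ?s = "sum_list (map fst xs)"
  have "jordan_matrix (x # xs)
      = four_block_mat (jordan_block l a) (0\<^sub>m l ?s) (0\<^sub>m ?s l) (jordan_matrix xs)"
    unfolding x by (rule jordan_matrix_Cons)
  then have "jordan_matrix (x # xs) $$ (i, j) =
      (if i < l then if j < l then jordan_block l a $$ (i, j) else 0
       else if j < l then 0 else jordan_matrix xs $$ (i - l, j - l))"
    using Cons.prems by (auto simp: x)
  moreover have "jordan_matrix xs $$ (i - l, j - l) = (if i - l = j - l then diag_entry xs (i - l)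
    else if j - l = Suc (i - l) \<and> chained (map fst xs) (i - l) then 1 else 0)"
    if "i \<ge> l" "j \<ge> l"
    using that Cons.prems by (intro Cons.IH) (auto simp: x)
  moreover have "i - l = j - l \<longleftrightarrow> i = j" "j - l = Suc (i - l) \<longleftrightarrow> j = Suc i"
    if "i \<ge> l" "j \<ge> l"
    using that by linarith+
  ultimately show ?case
    using Cons.prems by (cases "i < l"; cases "j < l") (auto simp: x)
qed simp

lemma jordan_matrix_mult_vec:
  fixes xs :: "(nat \<times> real) list"
  assumes n: "sum_list (map fst xs) = n" and y: "y \<in> carrier_vec n" and i: "i < n"
  shows "(jordan_matrix xs *\<^sub>v y) $ i =
    diag_entry xs i * y $ i + (if chained (map fst xs) i then y $ Suc i else 0)"
proof -
  let ?c = "chained (map fst xs) i"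
  have "(jordan_matrix xs *\<^sub>v y) $ i = (\<Sum>j<n. jordan_matrix xs $$ (i, j) * y $ j)"
    using jordan_matrix_carrier[of xs] n y i by (intro mult_mat_vec_index) auto
  \<comment> \<open>A row has at most two nonzero entries, on the diagonal and just right of
    it.\<close>
  also have "\<dots> = (\<Sum>j<n. (if j = i then diag_entry xs i * y $ i else 0)
      + (if j = Suc i then if ?c then y $ Suc i else 0 else 0))"
    using n i by (intro sum.cong) (auto simp: jordan_matrix_index)
  also have "\<dots> = diag_entry xs i * y $ i + (if ?c then y $ Suc i else 0)"
    using chained_less[of "map fst xs" i] n i by (auto simp: sum.distrib)
  finally show ?thesis .
qed

section \<open>The two obstructions to hypercyclicity\<close>

text \<open>
  The matrices \<open>T \<nu>\<close> act by \<open>y\<^sub>i \<mapsto> g \<nu> i * y\<^sub>i + y\<^sub>i\<^sub>+\<^sub>1\<close> if \<open>c i\<close>, that is, if \<open>i\<close> and \<open>i + 1\<close> belong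
  to the same block, and by \<open>y\<^sub>i \<mapsto> g \<nu> i * y\<^sub>i\<close> otherwise.
\<close>

locale jordan_tuple =
  fixes n k :: nat and T :: "nat \<Rightarrow> real mat"
    and c :: "nat \<Rightarrow> bool" and g :: "nat \<Rightarrow> nat \<Rightarrow> real"
  assumes carrier: "\<nu> \<in> {1..k} \<Longrightarrow> T \<nu> \<in> carrier_mat n n"
    and less: "c i \<Longrightarrow> Suc i < n"
    and g_Suc: "\<nu> \<in> {1..k} \<Longrightarrow> c i \<Longrightarrow> g \<nu> (Suc i) = g \<nu> i"
    and action: "\<nu> \<in> {1..k} \<Longrightarrow> y \<in> carrier_vec n \<Longrightarrow> i < n \<Longrightarrow>
      (T \<nu> *\<^sub>v y) $ i = g \<nu> i * y $ i + (if c i then y $ Suc i else 0)"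
begin

text \<open>A coordinate that ends a block is only scaled, so the hyperplane where it vanishes is
  invariant.\<close>

lemma dense_orbit_nonzero:
  assumes dense: "dense_vecs n {tuple_power n k T m *\<^sub>v x | m. True}" and x: "x \<in> carrier_vec n"
    and i: "i < n" "\<not> c i"
  shows "x $ i \<noteq> 0"
proof
  assume zero: "x $ i = 0"
  have "\<exists>y\<in>carrier_vec n. y $ i = 0 \<and> vec_point y \<in> {f. f i \<noteq> 0}"
  proof (rule dense_orbit_meets_open[OF dense x carrier])
    show "open {f :: nat \<Rightarrow> real. f i \<noteq> 0}"
      by (intro open_Collect_neq continuous_intros)
    show "vec n (\<lambda>_. 1) \<in> carrier_vec n" by simp
  qed (use zero i in \<open>simp_all add: action vec_point_index\<close>)
  then show False using i by (auto simp: vec_point_index)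
qed

lemma not_hypercyclic_large_block:
  assumes "c i" "c (Suc i)"
  shows "\<not> hypercyclic n k T"
proof
  assume "hypercyclic n k T"
  then obtain x where x: "x \<in> carrier_vec n"
    and dense: "dense_vecs n {tuple_power n k T m *\<^sub>v x | m. True}"
    unfolding hypercyclic_def by blast
  \<comment> \<open>The largest such \<open>j\<close> is taken so that the third coordinate ends its
    block.\<close>
  have "\<exists>j. (c j \<and> c (Suc j)) \<and> (\<forall>j'. c j' \<and> c (Suc j') \<longrightarrow> j' \<le> j)"
    using assms less by (intro ex_has_greatest_nat[where b = n and k = i]) (auto simp: less_imp_le Suc_lessD)
  then obtain j where j: "c j" "c (Suc j)" "\<not> c (Suc (Suc j))"
    by (metis Suc_n_not_le_n)
  then have n: "Suc (Suc j) < n" "Suc j < n" "j < n" using less[of "Suc j"] by auto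
  define a b d where [simp]: "a = j" "b = Suc j" "d = Suc (Suc j)"
  \<comment> \<open>Chosen so that \<open>x\<close> satisfies the invariant inequality with
    equality.\<close>
  define C where "C = ((x $ b)\<^sup>2 - 2 * x $ a * x $ d) / (x $ d)\<^sup>2"
  have "x $ d \<noteq> 0" using dense_orbit_nonzero[OF dense x] j n by simp
  let ?V = "{f. (f b)\<^sup>2 - 2 * f a * f d < C * (f d)\<^sup>2}"
  have "\<exists>y\<in>carrier_vec n. (y $ b)\<^sup>2 - 2 * y $ a * y $ d \<ge> C * (y $ d)\<^sup>2 \<and> vec_point y \<in> ?V"
  proof (rule dense_orbit_meets_open[OF dense x carrier])
    show "(x $ b)\<^sup>2 - 2 * x $ a * x $ d \<ge> C * (x $ d)\<^sup>2"
      using \<open>x $ d \<noteq> 0\<close> by (simp add: C_def)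
    show "open ?V" by (intro open_Collect_less continuous_intros)
    show "vec n (\<lambda>i. if i = a then \<bar>C\<bar> + 1 else if i = b then 0 else 1) \<in> carrier_vec n"
      by simp
    show "vec_point (vec n (\<lambda>i. if i = a then \<bar>C\<bar> + 1 else if i = b then 0 else 1)) \<in> ?V"
      using n by (simp add: vec_point_index)
  next
    fix \<nu> y
    assume \<nu>: "\<nu> \<in> {1..k}" and y: "y \<in> carrier_vec n"
      and P: "(y $ b)\<^sup>2 - 2 * y $ a * y $ d \<ge> C * (y $ d)\<^sup>2"
    define \<gamma> where "\<gamma> = g \<nu> j"
    have \<gamma>: "g \<nu> a = \<gamma>" "g \<nu> b = \<gamma>" "g \<nu> d = \<gamma>" using g_Suc[OF \<nu>] j by (simp_all add: \<gamma>_def)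
    let ?z = "T \<nu> *\<^sub>v y"
    have z: "?z $ a = \<gamma> * y $ a + y $ b" "?z $ b = \<gamma> * y $ b + y $ d" "?z $ d = \<gamma> * y $ d"
      using action[OF \<nu> y] n j \<gamma> by simp_all
    \<comment> \<open>The mixed terms \<open>2 * \<gamma> * y $ b * y $ d\<close> cancel.\<close>
    have "(?z $ b)\<^sup>2 - 2 * ?z $ a * ?z $ d = \<gamma>\<^sup>2 * ((y $ b)\<^sup>2 - 2 * y $ a * y $ d) + (y $ d)\<^sup>2"
      unfolding z by (simp add: power2_eq_square algebra_simps)
    moreover have "\<gamma>\<^sup>2 * ((y $ b)\<^sup>2 - 2 * y $ a * y $ d) \<ge> \<gamma>\<^sup>2 * (C * (y $ d)\<^sup>2)"
      using P by (intro mult_left_mono) auto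
    moreover have "C * (?z $ d)\<^sup>2 = \<gamma>\<^sup>2 * (C * (y $ d)\<^sup>2)"
      unfolding z by (simp add: power_mult_distrib)
    moreover have "(y $ d)\<^sup>2 \<ge> 0" by simp
    ultimately show "(?z $ b)\<^sup>2 - 2 * ?z $ a * ?z $ d \<ge> C * (?z $ d)\<^sup>2" by linarith
  qed
  then show False using n by (auto simp: vec_point_index)
qed

lemma not_hypercyclic_small_blocks:
  assumes small: "\<And>i. c i \<Longrightarrow> \<not> c (Suc i)" and "k = n" "n \<ge> 1"
  shows "\<not> hypercyclic n k T"
proof
  assume "hypercyclic n k T"
  then obtain x where x: "x \<in> carrier_vec n"
    and dense: "dense_vecs n {tuple_power n k T m *\<^sub>v x | m. True}"
    unfolding hypercyclic_def by blast
  \<comment> \<open>The values \<open>1 / 0\<close> and \<open>ln 0\<close> do no harm: if \<open>g \<nu> i = 0\<close>, then \<open>T \<nu>\<close> maps out of \<open>W\<close> below.\<close>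
  obtain \<phi> i\<^sub>0 where i\<^sub>0: "i\<^sub>0 < n" "\<phi> i\<^sub>0 \<noteq> 0"
    and \<phi>: "\<And>\<nu>. \<nu> \<in> {1..n} \<Longrightarrow>
      (\<Sum>i<n. \<phi> i * (if c i then 1 / g \<nu> i else ln \<bar>g \<nu> i\<bar>)) \<ge> 0"
    using half_space_of_n_vectors[OF \<open>n \<ge> 1\<close>,
        of "\<lambda>\<nu> i. if c i then 1 / g \<nu> i else ln \<bar>g \<nu> i\<bar>"] by blast
  define h :: "(nat \<Rightarrow> real) \<Rightarrow> nat \<Rightarrow> real"
    where "h f i = (if c i then f i / f (Suc i) else ln \<bar>f i\<bar>)" for f i
  define F where "F f = (\<Sum>i<n. \<phi> i * h f i)" for f
  define W where "W = (\<Inter>i\<in>{i. i < n \<and> \<not> c i}. {f :: nat \<Rightarrow> real. f i \<noteq> 0})"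
  have W: "f i \<noteq> 0" if "f \<in> W" "i < n" "\<not> c i" for f i
    using that by (auto simp: W_def)
  have "open W"
    unfolding W_def by (intro open_INT ballI open_Collect_neq continuous_intros) simp
  have "continuous_on W (\<lambda>f. h f i)" if "i < n" for i
    unfolding h_def using W that less[of i] small[of i]
    by (cases "c i") (auto intro!: continuous_intros)
  then have "continuous_on W F"
    unfolding F_def by (intro continuous_intros) simp
  define C where "C = F (vec_point x)"
  let ?V = "W \<inter> F -` {..<C}"
  \<comment> \<open>Being an implication, \<open>?P\<close> holds trivially outside
    \<open>W\<close>, which takes care of singular \<open>T \<nu>\<close>.\<close>
  let ?P = "\<lambda>y. vec_point y \<in> W \<longrightarrow> F (vec_point y) \<ge> C"
  \<comment> \<open>\<open>s\<close> prescribes the new coordinates \<open>h\<close> so that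
    \<open>F\<close> takes the value \<open>C - 1\<close>; \<open>v\<close> is the point with these
    coordinates.\<close>
  define s where "s i = (if i = i\<^sub>0 then (C - 1) / \<phi> i\<^sub>0 else 0)" for i
  define v where "v = vec n (\<lambda>i. if c i then s i * exp (s (Suc i)) else exp (s i))"
  have "\<exists>y\<in>carrier_vec n. ?P y \<and> vec_point y \<in> ?V"
  proof (rule dense_orbit_meets_open[OF dense x carrier])
    show "?P x" by (simp add: C_def)
    show "open ?V"
      using \<open>continuous_on W F\<close> \<open>open W\<close> by (intro continuous_open_preimage) auto
    show "v \<in> carrier_vec n" by (simp add: v_def)
    have "h (vec_point v) i = s i" if "i < n" for i
      using that less[of i] small[of i] by (auto simp: h_def v_def vec_point_index)
    then have "F (vec_point v) = (\<Sum>i<n. if i = i\<^sub>0 then C - 1 else 0)"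
      unfolding F_def using i\<^sub>0 by (intro sum.cong) (auto simp: s_def)
    then have "F (vec_point v) < C" using i\<^sub>0 by simp
    moreover have "vec_point v \<in> W" by (auto simp: W_def v_def vec_point_index)
    ultimately show "vec_point v \<in> ?V" by simp
  next
    fix \<nu> y
    assume \<nu>: "\<nu> \<in> {1..k}" and y: "y \<in> carrier_vec n" and P: "?P y"
    let ?z = "T \<nu> *\<^sub>v y"
    show "?P ?z"
    proof
      assume zW: "vec_point ?z \<in> W"
      have dim: "dim_vec y = n" "dim_vec ?z = n" using y carrier[OF \<nu>] by auto
      have z: "vec_point ?z i = g \<nu> i * vec_point y i + (if c i then vec_point y (Suc i) else 0)"
        if "i < n" for i
        using action[OF \<nu> y that] that less[of i] dim by (simp add: vec_point_index)
      have nz: "g \<nu> i \<noteq> 0 \<and> vec_point y i \<noteq> 0" if "i < n" "\<not> c i" for i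
        using W[OF zW that] z[OF that(1)] that by auto
      then have yW: "vec_point y \<in> W" by (auto simp: W_def)
      \<comment> \<open>The translation comes from
        \<open>(g * b + c) / (g * c) = b / c + 1 / g\<close> inside a block of size 2, and from
        additivity of the logarithm at block ends.\<close>
      have "h (vec_point ?z) i = h (vec_point y) i + (if c i then 1 / g \<nu> i else ln \<bar>g \<nu> i\<bar>)"
        if i: "i < n" for i
      proof (cases "c i")
        case True
        then have Suc: "Suc i < n" "\<not> c (Suc i)" "g \<nu> (Suc i) = g \<nu> i"
          using less small g_Suc[OF \<nu>] by auto
        then have "g \<nu> i \<noteq> 0" "vec_point y (Suc i) \<noteq> 0" using nz[of "Suc i"] by auto
        then show ?thesis using True Suc by (simp add: h_def z i field_simps)
      next
        case False
        then show ?thesis using nz[OF i] by (simp add: h_def z i abs_mult ln_mult)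
      qed
      then have "F (vec_point ?z) = F (vec_point y)
          + (\<Sum>i<n. \<phi> i * (if c i then 1 / g \<nu> i else ln \<bar>g \<nu> i\<bar>))"
        by (simp add: F_def distrib_left sum.distrib)
      \<comment> \<open>Since \<open>k = n\<close>, the half-space contains the translation vector
        of every \<open>T \<nu>\<close>, so \<open>F\<close> does not decrease.\<close>
      then show "F (vec_point ?z) \<ge> C" using P yW \<phi>[of \<nu>] \<nu> \<open>k = n\<close> by simp
    qed
  qed
  then show False by auto
qed

end

section \<open>Specialisation to Jordan matrices\<close>

theorem proposition1p8:
  fixes n k p :: nat
    and ns :: "nat \<Rightarrow> nat"
    and \<gamma> :: "nat \<Rightarrow> nat \<Rightarrow> real"
    and T :: "nat \<Rightarrow> real mat"
  assumes "n \<ge> 1" and "k \<ge> 1"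
    and "\<And>b. b \<in> {1..p} \<Longrightarrow> ns b \<ge> 1"
    and "(\<Sum>b = 1..p. ns b) = n"
    and "\<And>\<nu>. \<nu> \<in> {1..k} \<Longrightarrow> T \<nu> = jordan_matrix (map (\<lambda>b. (ns b, \<gamma> \<nu> b)) [1..<Suc p])"
    and "\<exists>b \<in> {1..p}. ns b > 1"
  shows "((\<exists>b \<in> {1..p}. ns b \<ge> 3) \<longrightarrow> \<not> hypercyclic n k T) \<and>
         (k = n \<longrightarrow> \<not> hypercyclic n k T)"
proof -
  define ls where "ls = map ns [1..<Suc p]"
  define xs where "xs \<nu> = map (\<lambda>b. (ns b, \<gamma> \<nu> b)) [1..<Suc p]" for \<nu>
  have fst_xs: "map fst (xs \<nu>) = ls" for \<nu>
    unfolding xs_def ls_def by (simp only: map_map o_def fst_conv)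
  have "sum_list ls = sum ns (set [1..<Suc p])"
    unfolding ls_def by (rule sum_list_distinct_conv_sum_set) simp
  also have "set [1..<Suc p] = {1..p}" by auto
  finally have sum_ls: "sum_list ls = n" using assms(4) by simp
  have T: "T \<nu> = jordan_matrix (xs \<nu>)" if "\<nu> \<in> {1..k}" for \<nu>
    using assms(5)[OF that] by (simp only: xs_def)
  interpret jordan_tuple n k T "chained ls" "\<lambda>\<nu>. diag_entry (xs \<nu>)"
  proof
    show "T \<nu> \<in> carrier_mat n n" if "\<nu> \<in> {1..k}" for \<nu>
      using jordan_matrix_carrier[of "xs \<nu>"] T[OF that] by (simp add: fst_xs sum_ls)
    show "Suc i < n" if "chained ls i" for i
      using chained_less[OF that] sum_ls by simp
    show "diag_entry (xs \<nu>) (Suc i) = diag_entry (xs \<nu>) i" if "chained ls i" for \<nu> i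
      using that by (intro diag_entry_chained) (simp add: fst_xs)
    show "(T \<nu> *\<^sub>v y) $ i
        = diag_entry (xs \<nu>) i * y $ i + (if chained ls i then y $ Suc i else 0)"
      if "\<nu> \<in> {1..k}" "y \<in> carrier_vec n" "i < n" for \<nu> y i
      using jordan_matrix_mult_vec[of "xs \<nu>" n y i] that T by (simp add: fst_xs sum_ls)
  qed
  have "\<not> hypercyclic n k T" if "b \<in> {1..p}" "ns b \<ge> 3" for b
  proof -
    have "ns b \<in> set ls" using that(1) by (auto simp: ls_def simp del: upt_Suc)
    then show ?thesis
      using chained_twice[OF _ that(2)] not_hypercyclic_large_block by blast
  qed
  \<comment> \<open>Either two consecutive indices are chained, which is the large-block case, or
    all blocks are small.\<close>
  moreover have "\<not> hypercyclic n k T" if "k = n"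
    using that assms(1) not_hypercyclic_large_block not_hypercyclic_small_blocks by blast
  ultimately show ?thesis by blast
qed

end
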